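(* Let $n\ge 2$, $\alpha\in\left(\frac{-1}{n-1},1\right)$ and $S\in EM^n_\alpha$. Then $$S^{-1}=\beta\, G_{\alpha'}S^T,\qquad\text{where}\qquad \beta=\frac{1+(n-2)\alpha}{(1-\alpha)\big(1+(n-1)\alpha\big)},\qquad \alpha'=\frac{-\alpha}{1+(n-2)\alpha},$$ and $S^{-1}$ can be computed (given $S$ and $\alpha$) with $O(n^2)$ arithmetic operations.
   Context: For $\alpha\in\left(\frac{-1}{n-1},1\right)$, $EM^n_\alpha$ denotes the set of nonsingular real $n\times n$ matrices $S=[s_1,\dots,s_n]$ whose columns satisfy $s_i^Ts_i=1$ and $s_i^Ts_j=\alpha$ for $i\ne j$. For a real number $\gamma$, $G_\gamma$ denotes the $n\times n$ matrix with all diagonal entries $1$ and all off-diagonal entries $\gamma$, i.e. $G_\gamma=(1-\gamma)I_n+\gamma ee^T$ with $e=[1,\dots,1]^T$. *)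

theory Defs
  imports
    "Jordan_Normal_Form.Gauss_Jordan_Elimination"
    "HOL-Library.Landau_Symbols"
begin

definition EM :: "nat \<Rightarrow> real \<Rightarrow> real mat set" where
  "EM n \<alpha> = {S \<in> carrier_mat n n. invertible_mat S \<and>
     (\<forall>i<n. col S i \<bullet> col S i = 1) \<and>
     (\<forall>i<n. \<forall>j<n. i \<noteq> j \<longrightarrow> col S i \<bullet> col S j = \<alpha>)}"

definition G :: "nat \<Rightarrow> real \<Rightarrow> real mat" where
  "G n \<gamma> = mat n n (\<lambda>(i, j). if i = j then 1 else \<gamma>)"

text \<open>\<^const>\<open>mat_inverse\<close> is defined in the library by Gauss-Jordan elimination; it is the
  matrix inverse in the usual sense.\<close>

lemma mat_inverse_eq_Some_iff:
  fixes A :: "'a :: field mat"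
  assumes A: "A \<in> carrier_mat n n"
  shows "mat_inverse A = Some B \<longleftrightarrow> B \<in> carrier_mat n n \<and> inverts_mat A B \<and> inverts_mat B A"
proof
  assume "mat_inverse A = Some B"
  from mat_inverse(2)[OF A this] A
  show "B \<in> carrier_mat n n \<and> inverts_mat A B \<and> inverts_mat B A"
    by (auto simp: inverts_mat_def)
next
  assume "B \<in> carrier_mat n n \<and> inverts_mat A B \<and> inverts_mat B A"
  then have B: "B \<in> carrier_mat n n" "A * B = 1\<^sub>m n" "B * A = 1\<^sub>m n"
    using A by (auto simp: inverts_mat_def)
  show "mat_inverse A = Some B"
  proof (cases "mat_inverse A")
    case None
    from mat_inverse(1)[OF A None, of undefined] A B show ?thesis
      by (auto simp: Units_def ring_mat_simps)
  next
    case (Some C)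
    from mat_inverse(2)[OF A Some]
    have C: "C * A = 1\<^sub>m n" "C \<in> carrier_mat n n" by auto
    have "C = C * (A * B)" using B C by simp
    also have "\<dots> = C * A * B" by (rule assoc_mult_mat[symmetric, OF C(2) A B(1)])
    also have "\<dots> = B" using B C by simp
    finally show ?thesis using Some by simp
  qed
qed

text \<open>Model of computation. Registers hold real numbers and are addressed by an array name and
  a row and a column index. An instruction stores \<open>1\<close>, or the result of one field operation,
  in its first register. An algorithm is a single program text for all dimensions: its register
  indices may mention loop variables, and each loop variable runs from \<open>0\<close> to \<open>n - 1\<close>, where
  \<open>n\<close> is the dimension. Fixing \<open>n\<close> and unrolling the loops gives a straight-line program, without
  any branching on real values.\<close>

datatype arith = Add | Sub | Mul | Div

datatype 'i reg = Reg nat 'i 'i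

datatype 'i instr =
    One "'i reg"
  | Arith arith "'i reg" "'i reg" "'i reg"

datatype index = Const nat | Var nat

datatype alg =
    Instr "index instr"
  | Seq alg alg
  | For nat alg

fun index_val :: "(nat \<Rightarrow> nat) \<Rightarrow> index \<Rightarrow> nat" where
  "index_val \<sigma> (Const k) = k"
| "index_val \<sigma> (Var v) = \<sigma> v"

fun unroll :: "nat \<Rightarrow> (nat \<Rightarrow> nat) \<Rightarrow> alg \<Rightarrow> nat instr list" where
  "unroll n \<sigma> (Instr c) = [map_instr (index_val \<sigma>) c]"
| "unroll n \<sigma> (Seq p q) = unroll n \<sigma> p @ unroll n \<sigma> q"
| "unroll n \<sigma> (For v p) = concat (map (\<lambda>i. unroll n (\<sigma>(v := i)) p) [0..<n])"

definition straight_line :: "nat \<Rightarrow> alg \<Rightarrow> nat instr list" where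
  "straight_line n p = unroll n (\<lambda>_. 0) p"

type_synonym store = "nat reg \<Rightarrow> real"

fun arith_val :: "arith \<Rightarrow> real \<Rightarrow> real \<Rightarrow> real option" where
  "arith_val Add x y = Some (x + y)"
| "arith_val Sub x y = Some (x - y)"
| "arith_val Mul x y = Some (x * y)"
| "arith_val Div x y = (if y = 0 then None else Some (x / y))"

fun step :: "nat instr \<Rightarrow> store \<Rightarrow> store option" where
  "step (One r) s = Some (s(r := 1))"
| "step (Arith f r a b) s =
     (case arith_val f (s a) (s b) of None \<Rightarrow> None | Some x \<Rightarrow> Some (s(r := x)))"

fun exec :: "nat instr list \<Rightarrow> store \<Rightarrow> store option" where
  "exec [] s = Some s"
| "exec (c # cs) s = (case step c s of None \<Rightarrow> None | Some t \<Rightarrow> exec cs t)"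

text \<open>Every executed instruction is charged one operation, including the loading of \<open>1\<close>.\<close>

definition op_count :: "alg \<Rightarrow> nat \<Rightarrow> nat" where
  "op_count p n = length (straight_line n p)"

text \<open>Array \<open>0\<close> receives \<open>S\<close>, register \<open>(0, 0)\<close> of array \<open>1\<close> receives \<open>\<alpha>\<close>, and the result is read
  from array \<open>2\<close>. The other registers have arbitrary initial contents.\<close>

definition holds_input :: "nat \<Rightarrow> real mat \<Rightarrow> real \<Rightarrow> store \<Rightarrow> bool" where
  "holds_input n S \<alpha> s \<longleftrightarrow>
     (\<forall>i<n. \<forall>j<n. s (Reg 0 i j) = S $$ (i, j)) \<and> s (Reg 1 0 0) = \<alpha>"

definition output_mat :: "nat \<Rightarrow> store \<Rightarrow> real mat" where
  "output_mat n t = mat n n (\<lambda>(i, j). t (Reg 2 i j))"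

definition computes_inverse_on_EM :: "alg \<Rightarrow> bool" where
  "computes_inverse_on_EM p \<longleftrightarrow>
     (\<forall>n\<ge>2. \<forall>\<alpha>\<in>{- 1 / (real n - 1)<..<1}. \<forall>S\<in>EM n \<alpha>. \<forall>s. holds_input n S \<alpha> s \<longrightarrow>
        (\<exists>t. exec (straight_line n p) s = Some t \<and> mat_inverse S = Some (output_mat n t)))"

end

theory Submission
  imports Defs "Jordan_Normal_Form.Determinant"
begin

text \<open>The columns give \<open>S\<^sup>T S = G\<^sub>\<alpha>\<close>, and \<open>\<beta> G\<^sub>\<alpha>\<^sub>'\<close> is the inverse of \<open>G\<^sub>\<alpha>\<close>, so \<open>\<beta> G\<^sub>\<alpha>\<^sub>' S\<^sup>T\<close> is a left
  inverse of \<open>S\<close>. Because \<open>G\<^sub>\<alpha>\<^sub>'\<close> is a rank-one perturbation of a scalar matrix, entry \<open>(i, j)\<close> of the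
  inverse is \<open>(S\<^sub>j\<^sub>i - c r\<^sub>j) / (1 - \<alpha>)\<close>, where \<open>r\<^sub>j\<close> is the sum of row \<open>j\<close> of \<open>S\<close> and
  \<open>c = \<alpha> / (1 + (n - 1) \<alpha>)\<close>. The \<open>n\<close> row sums cost \<open>O(n\<^sup>2)\<close> operations, and then each entry costs two
  more.\<close>

section \<open>The matrices \<open>G n \<gamma>\<close> and the explicit inverse\<close>

lemma G_carrier [simp]: "G n \<gamma> \<in> carrier_mat n n"
  by (simp add: G_def)

text \<open>Since G_\<gamma> = (1 - \<gamma>) I + \<gamma> ee^T, it acts on each column by scaling
  it and adding a multiple of its sum.\<close>

lemma index_G_mult:
  assumes A: "A \<in> carrier_mat n m" and i: "i < n" and j: "j < m"
  shows "(G n \<gamma> * A) $$ (i, j) = (1 - \<gamma>) * A $$ (i, j) + \<gamma> * (\<Sum>k<n. A $$ (k, j))"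
proof -
  have "(G n \<gamma> * A) $$ (i, j) = (\<Sum>k<n. (if i = k then 1 else \<gamma>) * A $$ (k, j))"
    using A i j by (simp add: G_def scalar_prod_def atLeast0LessThan)
  also have "\<dots> = (\<Sum>k<n. (if i = k then (1 - \<gamma>) * A $$ (k, j) else 0) + \<gamma> * A $$ (k, j))"
    by (intro sum.cong) (auto simp: algebra_simps)
  also have "\<dots> = (1 - \<gamma>) * A $$ (i, j) + \<gamma> * (\<Sum>k<n. A $$ (k, j))"
    using i by (simp add: sum.distrib sum_distrib_left)
  finally show ?thesis .
qed

lemma col_sum_G:
  assumes "j < n"
  shows "(\<Sum>k<n. G n \<gamma> $$ (k, j)) = 1 + (real n - 1) * \<gamma>"
proof -
  have "(\<Sum>k<n. G n \<gamma> $$ (k, j)) = (\<Sum>k<n. (if k = j then 1 - \<gamma> else 0) + \<gamma>)"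
    using assms by (intro sum.cong) (auto simp: G_def)
  also have "\<dots> = 1 + (real n - 1) * \<gamma>"
    using assms by (simp add: sum.distrib algebra_simps)
  finally show ?thesis .
qed

lemma EM_carrier: "S \<in> EM n \<alpha> \<Longrightarrow> S \<in> carrier_mat n n"
  by (simp add: EM_def)

lemma EM_gram:
  assumes "S \<in> EM n \<alpha>"
  shows "transpose_mat S * S = G n \<alpha>"
  using assms by (intro eq_matI) (auto simp: EM_def G_def)

context
  fixes n :: nat and \<alpha> :: real
  assumes n: "n \<ge> 2" and \<alpha>: "\<alpha> \<in> {- 1 / (real n - 1)<..<1}"
begin

lemma EM_denominators_pos:
  shows "1 - \<alpha> > 0" and "1 + (real n - 1) * \<alpha> > 0" and "1 + (real n - 2) * \<alpha> > 0"
proof -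
  show 1: "1 - \<alpha> > 0" using \<alpha> by simp
  show 2: "1 + (real n - 1) * \<alpha> > 0"
    using \<alpha> n by (simp add: field_simps)
  show "1 + (real n - 2) * \<alpha> > 0"
  proof (cases "\<alpha> \<ge> 0")
    case True
    then show ?thesis using n by (simp add: add_pos_nonneg)
  next
    case False
    \<comment> \<open>For \<alpha> < 0 this is the previous quantity increased by -\<alpha>.\<close>
    then show ?thesis using 2 by (simp add: algebra_simps)
  qed
qed

abbreviation (input) "scale_inv \<equiv> (1 + (real n - 2) * \<alpha>) / ((1 - \<alpha>) * (1 + (real n - 1) * \<alpha>))"
abbreviation (input) "angle_inv \<equiv> - \<alpha> / (1 + (real n - 2) * \<alpha>)"

text \<open>With a, b, d as in the proof, \<beta> = d / (a b), 1 - \<alpha>' = b / d and \<beta>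
  \<alpha>' = -\<alpha> / (a b), so d cancels. The formula serves twice: A = G_\<alpha> verifies the
  inverse, and A = S^T gives the entries that the algorithm evaluates.\<close>

lemma index_scaled_G_mult:
  assumes "A \<in> carrier_mat n m" and "i < n" and "j < m"
  shows "(scale_inv \<cdot>\<^sub>m (G n angle_inv * A)) $$ (i, j) =
    (A $$ (i, j) - \<alpha> / (1 + (real n - 1) * \<alpha>) * (\<Sum>k<n. A $$ (k, j))) / (1 - \<alpha>)"
proof -
  define a b d where "a = 1 - \<alpha>" and "b = 1 + (real n - 1) * \<alpha>" and "d = 1 + (real n - 2) * \<alpha>"
  have pos: "a \<noteq> 0" "b \<noteq> 0" "d \<noteq> 0"
    using EM_denominators_pos by (auto simp: a_def b_def d_def)
  have bd: "1 - (- \<alpha> / d) = b / d"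
    using pos by (simp add: field_simps) (simp add: b_def d_def algebra_simps)
  have "(scale_inv \<cdot>\<^sub>m (G n angle_inv * A)) $$ (i, j) =
      d / (a * b) * (b / d * A $$ (i, j) + (- \<alpha> / d) * (\<Sum>k<n. A $$ (k, j)))"
    using assms index_G_mult[OF assms, of "- \<alpha> / d"]
    unfolding a_def[symmetric] b_def[symmetric] d_def[symmetric] bd by (simp add: G_def)
  also have "\<dots> = (A $$ (i, j) - \<alpha> / b * (\<Sum>k<n. A $$ (k, j))) / a"
    using pos by (simp add: field_simps)
  finally show ?thesis by (simp add: a_def b_def)
qed

text \<open>Every column of G_\<alpha> sums to 1 + (n - 1) \<alpha>, which cancels the denominator
  of the correction term. What remains is (G_\<alpha> - \<alpha> ee^T) / (1 - \<alpha>) = I.\<close>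

lemma scaled_G_mult_G: "scale_inv \<cdot>\<^sub>m (G n angle_inv * G n \<alpha>) = 1\<^sub>m n"
proof (rule eq_matI)
  fix i j assume "i < dim_row (1\<^sub>m n :: real mat)" "j < dim_col (1\<^sub>m n :: real mat)"
  then have ij: "i < n" "j < n" by auto
  show "(scale_inv \<cdot>\<^sub>m (G n angle_inv * G n \<alpha>)) $$ (i, j) = 1\<^sub>m n $$ (i, j)"
    unfolding index_scaled_G_mult[OF G_carrier ij] col_sum_G[OF ij(2)]
    using EM_denominators_pos ij by (simp add: G_def)
qed (auto simp: G_def)

lemma mat_inverse_EM:
  assumes S: "S \<in> EM n \<alpha>"
  shows "mat_inverse S = Some (scale_inv \<cdot>\<^sub>m (G n angle_inv * transpose_mat S))"
proof -
  define B where "B = scale_inv \<cdot>\<^sub>m (G n angle_inv * transpose_mat S)"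
  have carr: "S \<in> carrier_mat n n" "transpose_mat S \<in> carrier_mat n n"
    using EM_carrier[OF S] by auto
  have B: "B \<in> carrier_mat n n"
    using mult_carrier_mat[OF G_carrier carr(2)] by (auto simp: B_def)
  have "B * S = scale_inv \<cdot>\<^sub>m (G n angle_inv * (transpose_mat S * S))"
    unfolding B_def
    by (subst mult_smult_assoc_mat[OF mult_carrier_mat[OF G_carrier carr(2)] carr(1)])
      (simp add: assoc_mult_mat[OF G_carrier carr(2,1)])
  also have "\<dots> = 1\<^sub>m n" by (simp only: EM_gram[OF S] scaled_G_mult_G)
  finally have BS: "B * S = 1\<^sub>m n" .
  have SB: "S * B = 1\<^sub>m n" by (rule mat_mult_left_right_inverse[OF B carr(1) BS])
  have "mat_inverse S = Some B"
    using mat_inverse_eq_Some_iff[OF carr(1)] B BS SB carr by (simp add: inverts_mat_def)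
  then show ?thesis by (simp add: B_def)
qed

end

section \<open>Hoare rules for unrolled programs\<close>

lemma exec_append:
  "exec (cs @ ds) s = (case exec cs s of None \<Rightarrow> None | Some t \<Rightarrow> exec ds t)"
  by (induction cs arbitrary: s) (auto split: option.splits)

text \<open>A Hoare triple for total correctness: the existence of a final store also excludes
  division by zero.\<close>

definition achieves ::
  "nat \<Rightarrow> (nat \<Rightarrow> nat) \<Rightarrow> (store \<Rightarrow> bool) \<Rightarrow> alg \<Rightarrow> (store \<Rightarrow> bool) \<Rightarrow> bool" where
  "achieves n \<sigma> P p Q \<longleftrightarrow> (\<forall>s. P s \<longrightarrow> (\<exists>t. exec (unroll n \<sigma> p) s = Some t \<and> Q t))"

lemma achieves_Instr:
  assumes "\<And>s. P s \<Longrightarrow> \<exists>t. step (map_instr (index_val \<sigma>) c) s = Some t \<and> Q t"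
  shows "achieves n \<sigma> P (Instr c) Q"
  unfolding achieves_def using assms by (fastforce split: option.splits)

lemma achieves_Seq:
  assumes "achieves n \<sigma> P p Q" and "achieves n \<sigma> Q q R"
  shows "achieves n \<sigma> P (Seq p q) R"
  using assms unfolding achieves_def by (fastforce simp: exec_append)

text \<open>The invariant is indexed by the number of completed passes.\<close>

lemma achieves_For:
  assumes step: "\<And>i. i < n \<Longrightarrow> achieves n (\<sigma>(v := i)) (I i) p (I (Suc i))"
  shows "achieves n \<sigma> (I 0) (For v p) (I n)"
proof -
  \<comment> \<open>The induction needs a separate bound m, because n also governs the loops nested
    inside \<open>p\<close> and must stay fixed.\<close>
  have "\<exists>t. exec (concat (map (\<lambda>i. unroll n (\<sigma>(v := i)) p) [0..<m])) s = Some t \<and> I m t"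
    if "I 0 s" "m \<le> n" for m s
    using that(2)
  proof (induction m)
    case 0
    then show ?case using that(1) by simp
  next
    case (Suc m)
    then obtain t where t: "exec (concat (map (\<lambda>i. unroll n (\<sigma>(v := i)) p) [0..<m])) s = Some t"
      "I m t" using Suc_leD by blast
    with step[of m] Suc.prems show ?case
      by (auto simp: achieves_def exec_append simp del: fun_upd_apply)
  qed
  then show ?thesis by (simp add: achieves_def)
qed

lemma achieves_conseq:
  assumes "achieves n \<sigma> P p Q" and "\<And>s. P' s \<Longrightarrow> P s" and "\<And>s. Q s \<Longrightarrow> Q' s"
  shows "achieves n \<sigma> P' p Q'"
  using assms unfolding achieves_def by blast

section \<open>The algorithm, its correctness and its cost\<close>

abbreviation scalar :: "nat \<Rightarrow> index reg" where
  "scalar k \<equiv> Reg k (Const 0) (Const 0)"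

text \<open>Array \<open>3\<close> holds \<open>1\<close>, array \<open>4\<close> holds \<open>1 - \<alpha>\<close>, and array \<open>5\<close> holds first \<open>1 + (n - 1) \<alpha>\<close>, accumulated
  as \<open>1 - \<alpha> + n \<alpha>\<close>, and then \<open>\<alpha> / (1 + (n - 1) \<alpha>)\<close>. Column \<open>0\<close> of array \<open>6\<close> holds the row sums of \<open>S\<close>
  multiplied by that quotient.\<close>

definition alg_scalars :: alg where
  "alg_scalars =
     Seq (Instr (One (scalar 3)))
    (Seq (Instr (Arith Sub (scalar 4) (scalar 3) (scalar 1)))
    (Seq (Instr (Arith Sub (scalar 5) (scalar 3) (scalar 1)))
    (Seq (For 0 (Instr (Arith Add (scalar 5) (scalar 5) (scalar 1))))
         (Instr (Arith Div (scalar 5) (scalar 1) (scalar 5))))))"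

text \<open>Registers start with arbitrary contents and 1 is the only loadable constant, so each sum
  is initialised to 0 as 1 - 1.\<close>

definition alg_row_sums :: alg where
  "alg_row_sums =
     For 0 (Seq (Instr (Arith Sub (Reg 6 (Var 0) (Const 0)) (scalar 3) (scalar 3)))
           (Seq (For 1 (Instr (Arith Add (Reg 6 (Var 0) (Const 0))
                   (Reg 6 (Var 0) (Const 0)) (Reg 0 (Var 0) (Var 1)))))
                (Instr (Arith Mul (Reg 6 (Var 0) (Const 0))
                   (scalar 5) (Reg 6 (Var 0) (Const 0))))))"

text \<open>The transpose costs nothing: it is read by swapping the indices of array 0.\<close>

definition alg_entries :: alg where
  "alg_entries =
     For 0 (For 1 (Seq
       (Instr (Arith Sub (Reg 2 (Var 0) (Var 1)) (Reg 0 (Var 1) (Var 0)) (Reg 6 (Var 1) (Const 0))))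
       (Instr (Arith Div (Reg 2 (Var 0) (Var 1)) (Reg 2 (Var 0) (Var 1)) (scalar 4)))))"

definition alg_inverse :: alg where
  "alg_inverse = Seq alg_scalars (Seq alg_row_sums alg_entries)"

text \<open>The content c of array 5 is a parameter, so that the predicate is also the invariant
  while the denominator is being accumulated there.\<close>

definition scalars_hold :: "nat \<Rightarrow> real mat \<Rightarrow> real \<Rightarrow> real \<Rightarrow> store \<Rightarrow> bool" where
  "scalars_hold n S \<alpha> c s \<longleftrightarrow> holds_input n S \<alpha> s \<and>
     s (Reg 3 0 0) = 1 \<and> s (Reg 4 0 0) = 1 - \<alpha> \<and> s (Reg 5 0 0) = c"

definition row_sums_hold :: "nat \<Rightarrow> real mat \<Rightarrow> real \<Rightarrow> nat \<Rightarrow> store \<Rightarrow> bool" where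
  "row_sums_hold n S c m s \<longleftrightarrow> (\<forall>i<m. s (Reg 6 i 0) = c * (\<Sum>j<n. S $$ (i, j)))"

lemma achieves_alg_scalars:
  assumes nz: "1 + (real n - 1) * \<alpha> \<noteq> 0"
  shows "achieves n \<sigma> (holds_input n S \<alpha>) alg_scalars
           (scalars_hold n S \<alpha> (\<alpha> / (1 + (real n - 1) * \<alpha>)))"
  unfolding alg_scalars_def
proof (intro achieves_Seq)
  \<comment> \<open>Loops make exactly n passes; starting from 1 - \<alpha> rather than 1 makes up
    for the extra one.\<close>
  let ?I = "\<lambda>m. scalars_hold n S \<alpha> (1 - \<alpha> + real m * \<alpha>)"
  show "achieves n \<sigma> (holds_input n S \<alpha>) (Instr (One (scalar 3)))
      (\<lambda>s. holds_input n S \<alpha> s \<and> s (Reg 3 0 0) = 1)"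
    by (rule achieves_Instr) (simp add: holds_input_def)
  show "achieves n \<sigma> (\<lambda>s. holds_input n S \<alpha> s \<and> s (Reg 3 0 0) = 1)
      (Instr (Arith Sub (scalar 4) (scalar 3) (scalar 1)))
      (\<lambda>s. holds_input n S \<alpha> s \<and> s (Reg 3 0 0) = 1 \<and> s (Reg 4 0 0) = 1 - \<alpha>)"
    by (rule achieves_Instr) (simp add: holds_input_def)
  show "achieves n \<sigma> (\<lambda>s. holds_input n S \<alpha> s \<and> s (Reg 3 0 0) = 1 \<and> s (Reg 4 0 0) = 1 - \<alpha>)
      (Instr (Arith Sub (scalar 5) (scalar 3) (scalar 1))) (?I 0)"
    by (rule achieves_Instr) (simp add: holds_input_def scalars_hold_def)
  show "achieves n \<sigma> (?I 0) (For 0 (Instr (Arith Add (scalar 5) (scalar 5) (scalar 1)))) (?I n)"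
    by (rule achieves_For, rule achieves_Instr)
      (simp add: holds_input_def scalars_hold_def algebra_simps)
  have "1 - \<alpha> + real n * \<alpha> = 1 + (real n - 1) * \<alpha>" by (simp add: algebra_simps)
  then show "achieves n \<sigma> (?I n) (Instr (Arith Div (scalar 5) (scalar 1) (scalar 5)))
      (scalars_hold n S \<alpha> (\<alpha> / (1 + (real n - 1) * \<alpha>)))"
    using nz by (intro achieves_Instr) (simp add: holds_input_def scalars_hold_def)
qed

lemma achieves_alg_row_sums:
  "achieves n \<sigma> (scalars_hold n S \<alpha> c) alg_row_sums
     (\<lambda>s. scalars_hold n S \<alpha> c s \<and> row_sums_hold n S c n s)"
proof -
  let ?I = "\<lambda>i s. scalars_hold n S \<alpha> c s \<and> row_sums_hold n S c i s"
  \<comment> \<open>Within row i the partial sum is still unscaled; the multiplication by c after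
    the inner loop leads to \<open>?I (Suc i)\<close>.\<close>
  let ?J = "\<lambda>i k s. ?I i s \<and> s (Reg 6 i 0) = (\<Sum>j<k. S $$ (i, j))"
  have "achieves n \<sigma> (?I 0) alg_row_sums (?I n)"
    unfolding alg_row_sums_def
  proof (intro achieves_For achieves_Seq)
    fix i assume i: "i < n"
    show "achieves n (\<sigma>(0 := i)) (?I i)
        (Instr (Arith Sub (Reg 6 (Var 0) (Const 0)) (scalar 3) (scalar 3))) (?J i 0)"
      by (rule achieves_Instr) (simp add: holds_input_def scalars_hold_def row_sums_hold_def)
    show "achieves n (\<sigma>(0 := i)) (?J i 0) (For 1 (Instr (Arith Add (Reg 6 (Var 0) (Const 0))
        (Reg 6 (Var 0) (Const 0)) (Reg 0 (Var 0) (Var 1))))) (?J i n)"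
      by (rule achieves_For, rule achieves_Instr)
        (use i in \<open>simp add: holds_input_def scalars_hold_def row_sums_hold_def\<close>)
    show "achieves n (\<sigma>(0 := i)) (?J i n) (Instr (Arith Mul (Reg 6 (Var 0) (Const 0))
        (scalar 5) (Reg 6 (Var 0) (Const 0)))) (?I (Suc i))"
      by (rule achieves_Instr)
        (simp add: holds_input_def scalars_hold_def row_sums_hold_def less_Suc_eq)
  qed
  then show ?thesis
    by (rule achieves_conseq) (simp_all add: row_sums_hold_def)
qed

text \<open>Row j of S is column j of S^T, so the result has the shape of
  \<open>index_scaled_G_mult\<close> for A = S^T.\<close>

lemma achieves_alg_entries:
  assumes nz: "\<alpha> \<noteq> 1"
  shows "achieves n \<sigma> (\<lambda>s. scalars_hold n S \<alpha> c s \<and> row_sums_hold n S c n s) alg_entries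
     (\<lambda>s. \<forall>i<n. \<forall>j<n. s (Reg 2 i j) = (S $$ (j, i) - c * (\<Sum>k<n. S $$ (j, k))) / (1 - \<alpha>))"
proof -
  let ?e = "\<lambda>i j. S $$ (j, i) - c * (\<Sum>k<n. S $$ (j, k))"
  let ?P = "\<lambda>s. scalars_hold n S \<alpha> c s \<and> row_sums_hold n S c n s"
  let ?I = "\<lambda>m s. ?P s \<and> (\<forall>i<m. \<forall>j<n. s (Reg 2 i j) = ?e i j / (1 - \<alpha>))"
  \<comment> \<open>Rows before i are complete, and row i is complete up to column m.\<close>
  let ?J = "\<lambda>i m s. ?I i s \<and> (\<forall>j<m. s (Reg 2 i j) = ?e i j / (1 - \<alpha>))"
  have "achieves n \<sigma> (?I 0) alg_entries (?I n)"
    unfolding alg_entries_def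
  proof (rule achieves_For)
    fix i assume i: "i < n"
    have "achieves n (\<sigma>(0 := i)) (?J i 0) (For 1 (Seq
       (Instr (Arith Sub (Reg 2 (Var 0) (Var 1)) (Reg 0 (Var 1) (Var 0)) (Reg 6 (Var 1) (Const 0))))
       (Instr (Arith Div (Reg 2 (Var 0) (Var 1)) (Reg 2 (Var 0) (Var 1)) (scalar 4))))) (?J i n)"
    proof (intro achieves_For achieves_Seq)
      fix j assume j: "j < n"
      show "achieves n (\<sigma>(0 := i, 1 := j)) (?J i j) (Instr (Arith Sub (Reg 2 (Var 0) (Var 1))
          (Reg 0 (Var 1) (Var 0)) (Reg 6 (Var 1) (Const 0)))) (\<lambda>s. ?J i j s \<and> s (Reg 2 i j) = ?e i j)"
        by (rule achieves_Instr)
          (use i j in \<open>simp add: holds_input_def scalars_hold_def row_sums_hold_def\<close>)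
      show "achieves n (\<sigma>(0 := i, 1 := j)) (\<lambda>s. ?J i j s \<and> s (Reg 2 i j) = ?e i j)
          (Instr (Arith Div (Reg 2 (Var 0) (Var 1)) (Reg 2 (Var 0) (Var 1)) (scalar 4)))
          (?J i (Suc j))"
        by (rule achieves_Instr)
          (use i j nz in \<open>simp add: holds_input_def scalars_hold_def row_sums_hold_def less_Suc_eq\<close>)
    qed
    then show "achieves n (\<sigma>(0 := i)) (?I i) (For 1 (Seq
       (Instr (Arith Sub (Reg 2 (Var 0) (Var 1)) (Reg 0 (Var 1) (Var 0)) (Reg 6 (Var 1) (Const 0))))
       (Instr (Arith Div (Reg 2 (Var 0) (Var 1)) (Reg 2 (Var 0) (Var 1)) (scalar 4)))))
       (?I (Suc i))"
      by (rule achieves_conseq) (auto simp: less_Suc_eq)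
  qed
  then show ?thesis
    by (rule achieves_conseq) simp_all
qed

lemma computes_inverse_on_EM_alg_inverse: "computes_inverse_on_EM alg_inverse"
  unfolding computes_inverse_on_EM_def
proof (intro allI ballI impI)
  fix n :: nat and \<alpha> :: real and S s
  assume n: "n \<ge> 2" and \<alpha>: "\<alpha> \<in> {- 1 / (real n - 1)<..<1}" and S: "S \<in> EM n \<alpha>"
    and s: "holds_input n S \<alpha> s"
  define c where "c = \<alpha> / (1 + (real n - 1) * \<alpha>)"
  note pos = EM_denominators_pos[OF n \<alpha>]
  have nz: "1 + (real n - 1) * \<alpha> \<noteq> 0" "\<alpha> \<noteq> 1" using pos by auto
  have "achieves n (\<lambda>_. 0) (holds_input n S \<alpha>) alg_inverse
     (\<lambda>s. \<forall>i<n. \<forall>j<n. s (Reg 2 i j) = (S $$ (j, i) - c * (\<Sum>k<n. S $$ (j, k))) / (1 - \<alpha>))"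
    unfolding alg_inverse_def c_def
    by (rule achieves_Seq[OF achieves_alg_scalars[OF nz(1)]
          achieves_Seq[OF achieves_alg_row_sums achieves_alg_entries[OF nz(2)]]])
  with s obtain t where t: "exec (straight_line n alg_inverse) s = Some t"
    and out: "\<And>i j. i < n \<Longrightarrow> j < n \<Longrightarrow>
      t (Reg 2 i j) = (S $$ (j, i) - c * (\<Sum>k<n. S $$ (j, k))) / (1 - \<alpha>)"
    unfolding achieves_def straight_line_def by blast
  let ?B = "(1 + (real n - 2) * \<alpha>) / ((1 - \<alpha>) * (1 + (real n - 1) * \<alpha>)) \<cdot>\<^sub>m
    (G n (- \<alpha> / (1 + (real n - 2) * \<alpha>)) * transpose_mat S)"
  have carr: "S \<in> carrier_mat n n" "transpose_mat S \<in> carrier_mat n n"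
    using EM_carrier[OF S] by auto
  have "output_mat n t = ?B"
  proof (rule eq_matI)
    fix i j assume "i < dim_row ?B" "j < dim_col ?B"
    then have ij: "i < n" "j < n" using carr by (auto simp: G_def)
    show "output_mat n t $$ (i, j) = ?B $$ (i, j)"
      unfolding index_scaled_G_mult[OF n \<alpha> carr(2) ij]
      using ij carr(1) by (simp add: output_mat_def out c_def)
  qed (use carr in \<open>auto simp: output_mat_def G_def\<close>)
  then show "\<exists>t. exec (straight_line n alg_inverse) s = Some t \<and>
      mat_inverse S = Some (output_mat n t)"
    using t mat_inverse_EM[OF n \<alpha> S] by auto
qed

text \<open>The three phases cost n + 4, n (n + 2) and 2 n^2 operations.\<close>

lemma op_count_alg_inverse: "op_count alg_inverse n = 3 * n\<^sup>2 + 3 * n + 4"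
  by (simp add: op_count_def straight_line_def alg_inverse_def alg_scalars_def alg_row_sums_def
      alg_entries_def length_concat comp_def sum_list_triv power2_eq_square algebra_simps)

lemma op_count_alg_inverse_bigo: "(\<lambda>n. real (op_count alg_inverse n)) \<in> O(\<lambda>n. (real n)\<^sup>2)"
\<comment> \<open>10 = 3 + 3 + 4, as n and 1 are at most n^2 once n is positive.\<close>
proof (rule bigoI[where c = 10])
  show "\<forall>\<^sub>F n in sequentially. norm (real (op_count alg_inverse n)) \<le> 10 * norm ((real n)\<^sup>2)"
    using eventually_ge_at_top[of "1::nat"]
  proof eventually_elim
    case (elim n)
    then have "op_count alg_inverse n \<le> 10 * n\<^sup>2"
      using mult_le_mono2[of 1 n n] unfolding op_count_alg_inverse power2_eq_square by linarith
    then have "real (op_count alg_inverse n) \<le> real (10 * n\<^sup>2)"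
      by (rule of_nat_mono)
    then show ?case by simp
  qed
qed

theorem proposition2p7:
  shows "(\<forall>n\<ge>2. \<forall>\<alpha>\<in>{- 1 / (real n - 1)<..<1}. \<forall>S\<in>EM n \<alpha>.
            let \<beta> = (1 + (real n - 2) * \<alpha>) / ((1 - \<alpha>) * (1 + (real n - 1) * \<alpha>));
                \<alpha>' = - \<alpha> / (1 + (real n - 2) * \<alpha>)
            in mat_inverse S = Some (\<beta> \<cdot>\<^sub>m (G n \<alpha>' * transpose_mat S))) \<and>
         (\<exists>p. computes_inverse_on_EM p \<and>
              (\<lambda>n. real (op_count p n)) \<in> O(\<lambda>n. (real n)\<^sup>2))"
  using mat_inverse_EM computes_inverse_on_EM_alg_inverse op_count_alg_inverse_bigo
  unfolding Let_def by blast

end
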